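(* Let $r_1,r_2$ be positive constants with $r_1^2+r_2^2=1$, let $c>0$, and let $(f,g)$ be one of the following pairs of functions: (i) $f(u_1)=\cosh(r_2\sqrt c\,u_1)$, $g(u_2)=\frac{r_2}{r_1}\sinh(r_1\sqrt c\,u_2)$; (ii) $f(u_1)=\sinh(r_2\sqrt c\,u_1)$, $g(u_2)=\frac{r_2}{r_1}\cosh(r_1\sqrt c\,u_2)$; (iii) $f(u_1)=a_1e^{\epsilon_1r_2\sqrt c\,u_1}$, $g(u_2)=b_1e^{\epsilon_2r_1\sqrt c\,u_2}$, with real constants $a_1,b_1\neq0$ and $\epsilon_1^2=\epsilon_2^2=1$. Put $\Omega=r_1r_2(f(u_1)+g(u_2))$, $W=r_2^2f(u_1)-r_1^2g(u_2)$, $S=(1+c)(\Omega^2+W^2)$, and let $\widetilde X$ be the flat surface in $S^3$ associated to the flat torus given by $$\widetilde X=\frac1S\begin{pmatrix}(r_1S-2r_1\Omega^2-2r_2\Omega W)\cos(r_2u_1)+2f'\Omega\sin(r_2u_1)\\ (r_1S-2r_1\Omega^2-2r_2\Omega W)\sin(r_2u_1)-2f'\Omega\cos(r_2u_1)\\ (r_2S-2r_2\Omega^2+2r_1\Omega W)\cos(r_1u_2)+2g'\Omega\sin(r_1u_2)\\ (r_2S-2r_2\Omega^2+2r_1\Omega W)\sin(r_1u_2)-2g'\Omega\cos(r_1u_2)\end{pmatrix}$$ defined on $$V=\{(u_1,u_2)\in\mathbb R^2:\ (r_1^2g^2-r_2^2f^2-2r_2^2fg)(r_2^2f^2-r_1^2g^2-2r_1^2fg)\neq0\}.$$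 Then $\widetilde X$ is complete.
   Context: $S^3$ is the unit sphere in $\mathbb R^4$ with its standard metric, and a surface in $S^3$ is flat if its induced metric has Gaussian curvature $0$. The surfaces $\widetilde X$ are the flat surfaces obtained by Ribaucour transformations from the flat torus $X(u_1,u_2)=(r_1\cos(r_2u_1),r_1\sin(r_2u_1),r_2\cos(r_1u_2),r_2\sin(r_1u_2))$ in $S^3$.
   Formalization: "Complete" is taken as: every path in the closure of V leaving all its compact subsets has infinite length; with divergence in V itself the claim is false, since the complement of V is nonempty and paths in V reach it in finite length. *)

theory Defs
  imports "HOL-Analysis.Analysis"
begin

lemma vector_4 [simp]:
  "(vector [w, x, y, z] :: 'a::zero ^ 4) $ 1 = w"
  "(vector [w, x, y, z] :: 'a::zero ^ 4) $ 2 = x"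
  "(vector [w, x, y, z] :: 'a::zero ^ 4) $ 3 = y"
  "(vector [w, x, y, z] :: 'a::zero ^ 4) $ 4 = z"
  unfolding vector_def by auto

section \<open>Completeness of parametrized surfaces\<close>

definition immersion_at :: "('a::euclidean_space \<Rightarrow> 'b::euclidean_space) \<Rightarrow> 'a \<Rightarrow> bool" where
  "immersion_at X p \<longleftrightarrow> X differentiable (at p) \<and> inj (frechet_derivative X (at p))"

definition divergent_path :: "'a::euclidean_space set \<Rightarrow> (real \<Rightarrow> 'a) \<Rightarrow> bool" where
  "divergent_path M \<gamma> \<longleftrightarrow>
     (\<forall>b\<ge>0. \<gamma> piecewise_C1_differentiable_on {0..b}) \<and>
     (\<forall>t\<ge>0. \<gamma> t \<in> M) \<and>
     (\<forall>K. compact K \<and> K \<subseteq> M \<longrightarrow> (\<forall>\<^sub>F t in at_top. \<gamma> t \<notin> K))"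

text \<open>The length of \<open>\<gamma>\<close> in the metric induced by \<open>X\<close> is the Euclidean length of \<open>X \<circ> \<gamma>\<close>.\<close>

definition induced_length ::
    "('a::euclidean_space \<Rightarrow> 'b::euclidean_space) \<Rightarrow> (real \<Rightarrow> 'a) \<Rightarrow> ennreal" where
  "induced_length X \<gamma> =
     (\<integral>\<^sup>+ t\<in>{0..}. ennreal (norm (vector_derivative (X \<circ> \<gamma>) (at t))) \<partial>lborel)"

definition divergent_paths_infinite ::
    "'a::euclidean_space set \<Rightarrow> ('a \<Rightarrow> 'b::euclidean_space) \<Rightarrow> bool" where
  "divergent_paths_infinite M X \<longleftrightarrow>
     (\<forall>\<gamma>. divergent_path M \<gamma> \<longrightarrow> induced_length X \<gamma> = \<infinity>)"

text \<open>
  Completeness in the divergent-path sense (every divergent path has infinite length)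
  for a surface \<open>X\<close> whose domain \<open>V\<close> is a domain of regularity: \<open>X\<close> is an immersion on the
  open set \<open>V\<close>, extends differentiably to \<open>closure V\<close>, and its induced metric degenerates on all
  of \<open>frontier V\<close>.  Paths may pass through the degenerate points, and a path is divergent if it
  leaves every compact subset of \<open>closure V\<close>.

  Pitfall: with \<open>V\<close> in place of \<open>closure V\<close>, that is, when running into \<open>frontier V\<close> counts as
  diverging, the notion fails whenever a smooth path of \<open>V\<close> ends at a point of \<open>frontier V\<close>,
  because such a path has finite length.  For the surfaces below \<open>frontier V\<close> is never empty: with
  \<open>Q = r2\<^sup>2 f\<^sup>2 + r1\<^sup>2 g\<^sup>2 > 0\<close> their induced metric is
  \<open>(r1 r2 / Q)\<^sup>2 (P1\<^sup>2 du1\<^sup>2 + P2\<^sup>2 du2\<^sup>2)\<close>, where \<open>P1\<close>, \<open>P2\<close> are the two factors in the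
  definition of \<open>V\<close>.
\<close>

definition complete_surface ::
    "'a::euclidean_space set \<Rightarrow> ('a \<Rightarrow> 'b::euclidean_space) \<Rightarrow> bool" where
  "complete_surface V X \<longleftrightarrow>
     open V \<and>
     (\<forall>p\<in>closure V. X differentiable (at p)) \<and>
     (\<forall>p\<in>V. immersion_at X p) \<and>
     (\<forall>p\<in>frontier V. \<not> immersion_at X p) \<and>
     divergent_paths_infinite (closure V) X"

section \<open>Surfaces associated to the flat torus\<close>

definition Omega_fun ::
    "real \<Rightarrow> real \<Rightarrow> (real \<Rightarrow> real) \<Rightarrow> (real \<Rightarrow> real) \<Rightarrow> real \<times> real \<Rightarrow> real" where
  "Omega_fun r1 r2 f g = (\<lambda>(u1, u2). r1 * r2 * (f u1 + g u2))"

definition W_fun ::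
    "real \<Rightarrow> real \<Rightarrow> (real \<Rightarrow> real) \<Rightarrow> (real \<Rightarrow> real) \<Rightarrow> real \<times> real \<Rightarrow> real" where
  "W_fun r1 r2 f g = (\<lambda>(u1, u2). r2\<^sup>2 * f u1 - r1\<^sup>2 * g u2)"

definition S_fun ::
    "real \<Rightarrow> real \<Rightarrow> real \<Rightarrow> (real \<Rightarrow> real) \<Rightarrow> (real \<Rightarrow> real) \<Rightarrow> real \<times> real \<Rightarrow> real" where
  "S_fun r1 r2 c f g = (\<lambda>u. (1 + c) * ((Omega_fun r1 r2 f g u)\<^sup>2 + (W_fun r1 r2 f g u)\<^sup>2))"

definition X_tilde ::
    "real \<Rightarrow> real \<Rightarrow> real \<Rightarrow> (real \<Rightarrow> real) \<Rightarrow> (real \<Rightarrow> real) \<Rightarrow> real \<times> real \<Rightarrow> real ^ 4" where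
  "X_tilde r1 r2 c f g = (\<lambda>(u1, u2).
     let \<Omega> = Omega_fun r1 r2 f g (u1, u2);
         W = W_fun r1 r2 f g (u1, u2);
         S = S_fun r1 r2 c f g (u1, u2);
         A = r1 * S - 2 * r1 * \<Omega>\<^sup>2 - 2 * r2 * \<Omega> * W;
         B = r2 * S - 2 * r2 * \<Omega>\<^sup>2 + 2 * r1 * \<Omega> * W
     in (1 / S) *\<^sub>R vector
          [A * cos (r2 * u1) + 2 * deriv f u1 * \<Omega> * sin (r2 * u1),
           A * sin (r2 * u1) - 2 * deriv f u1 * \<Omega> * cos (r2 * u1),
           B * cos (r1 * u2) + 2 * deriv g u2 * \<Omega> * sin (r1 * u2),
           B * sin (r1 * u2) - 2 * deriv g u2 * \<Omega> * cos (r1 * u2)])"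

definition V_dom ::
    "real \<Rightarrow> real \<Rightarrow> (real \<Rightarrow> real) \<Rightarrow> (real \<Rightarrow> real) \<Rightarrow> (real \<times> real) set" where
  "V_dom r1 r2 f g = {(u1, u2).
     (r1\<^sup>2 * (g u2)\<^sup>2 - r2\<^sup>2 * (f u1)\<^sup>2 - 2 * r2\<^sup>2 * f u1 * g u2) *
     (r2\<^sup>2 * (f u1)\<^sup>2 - r1\<^sup>2 * (g u2)\<^sup>2 - 2 * r1\<^sup>2 * f u1 * g u2) \<noteq> 0}"

end

theory Submission
  imports Defs
begin

text \<open>
  \<open>X_tilde\<close> is the torus reflected in a moving hyperplane.  With \<open>C1\<close>, \<open>C2\<close> the unit circles
  in the two coordinate planes and \<open>T1\<close>, \<open>T2\<close> their tangents, put
  \<open>\<eta> = r2 f C1 + f' T1 + r1 g C2 + g' T2\<close>.  Then \<open>\<Omega>\<close> is the inner product of \<open>\<eta>\<close> with the torus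
  \<open>X = r1 C1 + r2 C2\<close>, \<open>S\<close> is \<open>\<parallel>\<eta>\<parallel>\<^sup>2\<close>, and \<open>X_tilde = X - (2 \<Omega> / S) \<eta>\<close>.  The equations
  \<open>f'' = c r2\<^sup>2 f\<close> and \<open>g'' = c r1\<^sup>2 g\<close> make \<open>d\<eta>\<close> a combination of \<open>T1 du1\<close> and \<open>T2 du2\<close>, so the
  derivative of \<open>X_tilde\<close> sends the coordinate directions to multiples \<open>stretch1\<close>, \<open>stretch2\<close> of
  the mutually orthogonal unit vectors obtained by reflecting \<open>T1\<close> and \<open>T2\<close>.  The immersion fails
  exactly where one of these two factors vanishes, and that is the complement of \<open>V_dom\<close>.

  For the lengths of divergent paths, let \<open>\<theta>\<close> be the polar angle of the point \<open>(r2 f, r1 g)\<close>,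
  \<open>\<phi>\<close> that of \<open>(r1, r2)\<close>, and \<open>\<psi> = 2 \<theta> - \<phi>\<close>.  The factors are \<open>- r2 cos \<psi>\<close> and
  \<open>- r1 sin \<psi>\<close>, so in the characteristic coordinates \<open>s, t = sqrt c (r2 u1 \<plusminus> r1 u2)\<close> the induced
  metric is \<open>(ds\<^sup>2 + dt\<^sup>2 + 2 cos (2 \<psi>) ds dt) / (4 c)\<close>, a Chebyshev net.  Flatness means that the
  angle \<open>2 \<psi>\<close> is a function of \<open>s\<close> plus a function of \<open>t\<close>; for the functions \<open>f\<close>, \<open>g\<close> considered
  here this is explicit, each summand being constant or that of a one-soliton solution of the
  sine-Gordon equation.  Consequently the metric is the pull-back of the Euclidean one under a map
  into the complex plane of the form \<open>(\<rho>\<^sup>2 F1 s + F2 t) / (2 sqrt c)\<close> with \<open>\<rho> = r1 - \<i> r2\<close>, where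
  \<open>F1\<close> and \<open>F2\<close> are unit-speed curves.  A soliton turns the tangent by a full turn in total, so
  \<open>F1 s\<close> and \<open>F2 t\<close> stay at bounded distance from \<open>s\<close> and \<open>t\<close>.  As \<open>\<rho>\<^sup>2\<close> is not real,
  the map is proper.  Every path that leaves all compact sets is therefore sent to an unbounded
  path in the plane, of the same length, and that length is infinite.
\<close>

section \<open>Divergent paths and proper short maps\<close>

text \<open>
  \<open>D \<circ> \<gamma>\<close> is at most as fast as \<open>X \<circ> \<gamma>\<close>, so this is the fundamental theorem of calculus for
  \<open>D \<circ> \<gamma>\<close>.  The velocity of a piecewise \<open>C\<^sup>1\<close> path can be unbounded near the exceptional points,
  hence the fundamental theorem only gives a gauge integral; when the length is finite, the
  velocity of \<open>D \<circ> \<gamma>\<close> is also Lebesgue integrable and the two integrals agree.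
\<close>

lemma displacement_le_induced_length:
  fixes X :: "'a::euclidean_space \<Rightarrow> 'b::euclidean_space" and D :: "'a \<Rightarrow> 'c::euclidean_space"
  assumes X: "\<And>p. (X has_derivative X' p) (at p)"
    and D: "\<And>p. (D has_derivative D' p) (at p)"
    and cont: "continuous_on UNIV (\<lambda>(p, v). D' p v)"
    and le: "\<And>p v. norm (D' p v) \<le> norm (X' p v)"
    and \<gamma>: "\<gamma> piecewise_C1_differentiable_on {0..b}" and b: "b \<ge> 0"
  shows "ennreal (norm (D (\<gamma> b) - D (\<gamma> 0))) \<le> induced_length X \<gamma>"
proof -
  obtain S G where cg: "continuous_on {0..b} \<gamma>" and S: "finite S"
    and G: "\<And>t. t \<in> {0..b} - S \<Longrightarrow> (\<gamma> has_vector_derivative G t) (at t)"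
    and contG: "continuous_on ({0..b} - S) G"
    using \<gamma> unfolding piecewise_C1_differentiable_on_def C1_differentiable_on_def by metis
  have chain: "((\<lambda>t. Z (\<gamma> t)) has_vector_derivative Z' (\<gamma> t) (G t)) (at t)"
    if "\<And>p. (Z has_derivative Z' p) (at p)" "t \<in> {0..b} - S"
    for Z :: "'a \<Rightarrow> 'd::euclidean_space" and Z' t
    using has_derivative_compose[OF G[OF that(2), unfolded has_vector_derivative_def] that(1)]
      linear_scale[OF has_derivative_linear[OF that(1)]]
    by (simp add: has_vector_derivative_def)
  define h where "h t = indicat_real ({0..b} - S) t *\<^sub>R D' (\<gamma> t) (G t)" for t
  have meas: "h \<in> borel_measurable borel"
    unfolding h_def
  proof (rule borel_measurable_continuous_on_indicator)
    show "{0..b} - S \<in> sets borel"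
      using S by (intro sets.Diff borel_closed) (auto intro: finite_imp_closed)
    have "continuous_on ({0..b} - S) (\<lambda>t. (\<lambda>(p, v). D' p v) (\<gamma> t, G t))"
      by (rule continuous_on_compose2[OF cont])
         (auto intro!: continuous_intros contG continuous_on_subset[OF cg])
    then show "continuous_on ({0..b} - S) (\<lambda>t. D' (\<gamma> t) (G t))" by simp
  qed
  have "continuous_on UNIV D"
    using D by (meson continuous_at_imp_continuous_on has_derivative_continuous)
  then have "continuous_on {0..b} (\<lambda>t. D (\<gamma> t))"
    by (rule continuous_on_compose2[OF _ cg]) auto
  then have "((\<lambda>t. D' (\<gamma> t) (G t)) has_integral (D (\<gamma> b) - D (\<gamma> 0))) {0..b}"
    by (intro fundamental_theorem_of_calculus_interior_strong[OF S b])
       (auto intro: chain[OF D])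
  then have "(h has_integral (D (\<gamma> b) - D (\<gamma> 0))) {0..b}"
    by (rule has_integral_spike_finite[OF S, rotated]) (auto simp: h_def)
  then have hi: "(h has_integral (D (\<gamma> b) - D (\<gamma> 0))) UNIV"
    by (rule has_integral_on_superset) (auto simp: h_def)
  have length: "(\<integral>\<^sup>+ t. ennreal (norm (h t)) \<partial>lborel) \<le> induced_length X \<gamma>"
    unfolding induced_length_def
  proof (rule nn_integral_mono)
    fix t
    have "vector_derivative (X \<circ> \<gamma>) (at t) = X' (\<gamma> t) (G t)" if "t \<in> {0..b} - S"
      using chain[OF X that] by (simp add: o_def vector_derivative_at)
    then show "ennreal (norm (h t)) \<le>
        ennreal (norm (vector_derivative (X \<circ> \<gamma>) (at t))) * indicator {0..} t"
      using le by (auto simp: h_def indicator_def ennreal_leI)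
  qed
  show ?thesis
  proof (cases "(\<integral>\<^sup>+ t. ennreal (norm (h t)) \<partial>lborel) < \<infinity>")
    case True
    then have int: "integrable lborel h" using meas by (simp add: integrable_iff_bounded)
    have "D (\<gamma> b) - D (\<gamma> 0) = integral\<^sup>L lborel h"
      using has_integral_unique[OF hi has_integral_integral_lborel[OF int]] .
    then show ?thesis
      using integral_norm_bound_ennreal[OF int] length by (metis order_trans)
  next
    case False
    then show ?thesis using length by (metis infinity_ennreal_def less_top neq_top_trans top_greatest)
  qed
qed

text \<open>
  A path of finite length keeps \<open>D \<circ> \<gamma>\<close> bounded; by properness \<open>\<gamma>\<close> then stays in one compact
  set and does not diverge.
\<close>

lemma divergent_paths_infinite_if_proper_short_map:
  fixes X :: "'a::euclidean_space \<Rightarrow> 'b::euclidean_space" and D :: "'a \<Rightarrow> 'c::euclidean_space"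
  assumes X: "\<And>p. (X has_derivative X' p) (at p)"
    and D: "\<And>p. (D has_derivative D' p) (at p)"
    and cont: "continuous_on UNIV (\<lambda>(p, v). D' p v)"
    and le: "\<And>p v. norm (D' p v) \<le> norm (X' p v)"
    and proper: "\<And>R. bounded {p. norm (D p) \<le> R}"
    and M: "closed M"
  shows "divergent_paths_infinite M X"
  unfolding divergent_paths_infinite_def
proof (intro allI impI)
  fix \<gamma> assume \<gamma>: "divergent_path M \<gamma>"
  show "induced_length X \<gamma> = \<infinity>"
  proof (rule ccontr)
    assume "induced_length X \<gamma> \<noteq> \<infinity>"
    then obtain L where L: "induced_length X \<gamma> = ennreal L" "L \<ge> 0"
      by (cases "induced_length X \<gamma>") auto
    define K where "K = M \<inter> closure {p. norm (D p) \<le> norm (D (\<gamma> 0)) + L}"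
    have "compact K"
      unfolding K_def by (intro closed_Int_compact M) (simp add: proper compact_closure)
    moreover have "\<gamma> t \<in> K" if "t \<ge> 0" for t
    proof -
      have "\<gamma> piecewise_C1_differentiable_on {0..t}" "\<gamma> t \<in> M"
        using \<gamma> that by (auto simp: divergent_path_def)
      then have "ennreal (norm (D (\<gamma> t) - D (\<gamma> 0))) \<le> ennreal L"
        unfolding L(1)[symmetric]
        by (intro displacement_le_induced_length[OF X D cont le _ that])
      then have "norm (D (\<gamma> t) - D (\<gamma> 0)) \<le> L" using L by simp
      then have "norm (D (\<gamma> t)) \<le> norm (D (\<gamma> 0)) + L"
        using norm_triangle_sub[of "D (\<gamma> t)" "D (\<gamma> 0)"] by linarith
      then show ?thesis
        using \<open>\<gamma> t \<in> M\<close> closure_subset[of "{p. norm (D p) \<le> norm (D (\<gamma> 0)) + L}"]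
        by (auto simp: K_def)
    qed
    moreover have "K \<subseteq> M" by (auto simp: K_def)
    ultimately have "\<forall>\<^sub>F t in at_top. \<gamma> t \<notin> K" "\<forall>\<^sub>F t in at_top. \<gamma> t \<in> K"
      using \<gamma> by (auto simp: divergent_path_def intro: eventually_at_top_linorderI[of 0])
    then have "\<forall>\<^sub>F t::real in at_top. False" by eventually_elim simp
    then show False by simp
  qed
qed

section \<open>Plane curves asymptotic to a line and the angle of a Chebyshev net\<close>

text \<open>
  \<open>F\<close> is a unit-speed curve whose tangent is written as a square, because the half-angle is what
  enters the angle of the net, and the point \<open>F s\<close> stays at bounded distance from \<open>s\<close>.
\<close>

definition straightening :: "(real \<Rightarrow> complex) \<Rightarrow> (real \<Rightarrow> complex) \<Rightarrow> bool" where
  "straightening z F \<longleftrightarrow>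
     continuous_on UNIV z \<and> (\<forall>s. norm (z s) = 1) \<and>
     (\<forall>s. (F has_vector_derivative (z s)\<^sup>2) (at s)) \<and>
     bounded (range (\<lambda>s. F s - of_real s))"

lemma straightening_line: "straightening (\<lambda>_. 1) of_real"
  by (auto simp: straightening_def has_vector_derivative_def scaleR_conv_of_real
      intro!: derivative_eq_intros)

text \<open>
  For \<open>\<sigma> = 1\<close> this is \<open>exp (2 \<i> arctan (exp s))\<close>, and \<open>\<sigma> = - 1\<close> gives its conjugate.  The angle
  \<open>4 arctan (exp s)\<close> of the square is the sine-Gordon kink.
\<close>

definition kink :: "real \<Rightarrow> real \<Rightarrow> complex" where
  "kink \<sigma> s = Complex (- tanh s) (\<sigma> / cosh s)"

definition kink_curve :: "real \<Rightarrow> real \<Rightarrow> complex" where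
  "kink_curve \<sigma> s = Complex (s - 2 * tanh s) (2 * \<sigma> / cosh s)"

lemma kink_curve_derivative:
  assumes "\<sigma>\<^sup>2 = 1"
  shows "(kink_curve \<sigma> has_vector_derivative (kink \<sigma> s)\<^sup>2) (at s)"
proof -
  have 1: "((\<lambda>s. s - 2 * tanh s) has_real_derivative (tanh s)\<^sup>2 - (\<sigma> / cosh s)\<^sup>2) (at s)"
  proof -
    have "(sinh s)\<^sup>2 + 1 > 0" by (simp add: add_nonneg_pos)
    then have "(\<sigma> / cosh s)\<^sup>2 = 1 - (tanh s)\<^sup>2"
      using assms cosh_square_eq[of s] by (simp add: tanh_def power_divide divide_simps)
    then show ?thesis by (auto intro!: derivative_eq_intros)
  qed
  have 2: "((\<lambda>s. 2 * \<sigma> / cosh s) has_real_derivative - (2 * tanh s * (\<sigma> / cosh s))) (at s)"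
    by (auto intro!: derivative_eq_intros simp: tanh_def divide_simps power2_eq_square)
  have "(kink \<sigma> s)\<^sup>2 = Complex ((tanh s)\<^sup>2 - (\<sigma> / cosh s)\<^sup>2) (- (2 * tanh s * (\<sigma> / cosh s)))"
    by (simp add: kink_def complex_eq_iff power2_eq_square)
  with 1 2 show ?thesis
    by (simp add: has_vector_derivative_complex_iff kink_curve_def
        has_real_derivative_iff_has_vector_derivative)
qed

lemma norm_kink:
  assumes "\<sigma>\<^sup>2 = 1"
  shows "norm (kink \<sigma> s) = 1"
proof -
  have "(sinh s)\<^sup>2 + 1 > 0" by (simp add: add_nonneg_pos)
  then show ?thesis
    using assms cosh_square_eq[of s]
    by (simp add: kink_def cmod_def tanh_def power_divide divide_simps)
qed

text \<open>
  Reversing the parameter (\<open>\<epsilon> = - 1\<close>) would make the curve run against the line; the outer factor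
  \<open>\<epsilon>\<close> turns it back.
\<close>

lemma straightening_kink:
  assumes "\<sigma>\<^sup>2 = 1" "\<epsilon>\<^sup>2 = 1"
  shows "straightening (\<lambda>s. kink \<sigma> (\<epsilon> * s + k)) (\<lambda>s. \<epsilon> *\<^sub>R kink_curve \<sigma> (\<epsilon> * s + k))"
  unfolding straightening_def
proof (intro conjI allI)
  show "continuous_on UNIV (\<lambda>s. kink \<sigma> (\<epsilon> * s + k))"
    unfolding kink_def Complex_eq by (intro continuous_intros) auto
  show "norm (kink \<sigma> (\<epsilon> * s + k)) = 1" for s using assms by (simp add: norm_kink)
  show "((\<lambda>s. \<epsilon> *\<^sub>R kink_curve \<sigma> (\<epsilon> * s + k)) has_vector_derivative
      (kink \<sigma> (\<epsilon> * s + k))\<^sup>2) (at s)" for s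
  proof -
    have "((\<lambda>s. \<epsilon> * s + k) has_vector_derivative \<epsilon>) (at s)"
      by (auto intro!: derivative_eq_intros)
    from has_vector_derivative_scaleR[OF DERIV_const
        vector_diff_chain_at[OF this kink_curve_derivative[OF assms(1)]], of \<epsilon>]
    show ?thesis using assms(2) by (simp add: o_def flip: power2_eq_square)
  qed
  have "norm (\<epsilon> *\<^sub>R kink_curve \<sigma> (\<epsilon> * s + k) - of_real s) \<le> \<bar>k\<bar> + 4" for s
  proof -
    define m where "m = \<epsilon> * s + k"
    have abs: "\<bar>\<epsilon>\<bar> = 1" "\<bar>\<sigma>\<bar> = 1" using assms by (auto simp: power2_eq_1_iff)
    have "\<epsilon> * m = s + \<epsilon> * k" using assms(2) by (simp add: m_def algebra_simps power2_eq_square)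
    then have "\<epsilon> *\<^sub>R kink_curve \<sigma> m - of_real s = Complex (\<epsilon> * k - \<epsilon> * (2 * tanh m)) (\<epsilon> * (2 * \<sigma> / cosh m))"
      by (simp add: kink_curve_def complex_eq_iff algebra_simps)
    then have "norm (\<epsilon> *\<^sub>R kink_curve \<sigma> m - of_real s)
        \<le> \<bar>\<epsilon> * k - \<epsilon> * (2 * tanh m)\<bar> + \<bar>\<epsilon> * (2 * \<sigma> / cosh m)\<bar>"
      by (metis cmod_le complex.sel)
    also have "\<dots> \<le> (\<bar>\<epsilon> * k\<bar> + \<bar>\<epsilon> * (2 * tanh m)\<bar>) + \<bar>\<epsilon> * (2 * \<sigma> / cosh m)\<bar>"
      by (intro add_right_mono abs_triangle_ineq4)
    also have "\<dots> = \<bar>k\<bar> + 2 * \<bar>tanh m\<bar> + 2 / cosh m"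
      using abs by (simp add: abs_mult)
    also have "\<dots> \<le> \<bar>k\<bar> + 2 + 2"
      using tanh_real_bounds[of m] cosh_real_ge_1[of m]
      by (intro add_mono) (auto simp: divide_simps)
    finally show ?thesis by (simp add: m_def)
  qed
  then show "bounded (range (\<lambda>s. \<epsilon> *\<^sub>R kink_curve \<sigma> (\<epsilon> * s + k) - of_real s))"
    unfolding bounded_iff by blast
qed

text \<open>
  Up to the unit factor \<open>\<rho> \<zeta> \<xi>\<close> the vector is \<open>a w + b (cnj w)\<close> with \<open>w = \<rho> \<zeta> (cnj \<xi>)\<close>.  This
  diagonalizes the metric of a Chebyshev net whose half-angle is the argument of \<open>w\<close>: the
  bisectors of the net are the orthogonal directions.
\<close>

lemma norm_chebyshev_form:
  assumes "norm \<rho> = 1" "norm \<zeta> = 1" "norm \<xi> = 1"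
  shows "(norm (\<rho>\<^sup>2 * (a *\<^sub>R \<zeta>\<^sup>2) + b *\<^sub>R \<xi>\<^sup>2))\<^sup>2
    = ((a + b) * Re (\<rho> * \<zeta> * cnj \<xi>))\<^sup>2 + ((a - b) * Im (\<rho> * \<zeta> * cnj \<xi>))\<^sup>2"
proof -
  define w where "w = \<rho> * \<zeta> * cnj \<xi>"
  have unit: "\<rho> * cnj \<rho> = 1" "\<zeta> * cnj \<zeta> = 1" "\<xi> * cnj \<xi> = 1"
    using assms by (simp_all flip: complex_norm_square)
  have "\<rho>\<^sup>2 * (of_real a * \<zeta>\<^sup>2) + of_real b * \<xi>\<^sup>2
      = \<rho>\<^sup>2 * (of_real a * \<zeta>\<^sup>2) * (\<xi> * cnj \<xi>) + of_real b * \<xi>\<^sup>2 * (\<rho> * cnj \<rho>) * (\<zeta> * cnj \<zeta>)"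
    by (simp add: unit)
  also have "\<dots> = (\<rho> * \<zeta> * \<xi>) * (of_real a * w + of_real b * cnj w)"
    by (simp add: w_def algebra_simps power2_eq_square)
  also have "of_real a * w + of_real b * cnj w = Complex ((a + b) * Re w) ((a - b) * Im w)"
    by (simp add: complex_eq_iff algebra_simps)
  finally have "norm (\<rho>\<^sup>2 * (a *\<^sub>R \<zeta>\<^sup>2) + b *\<^sub>R \<xi>\<^sup>2)
      = norm (Complex ((a + b) * Re w) ((a - b) * Im w))"
    unfolding scaleR_conv_of_real by (simp only: norm_mult assms mult_1)
  then show ?thesis by (simp only: cmod_power2 complex.sel w_def)
qed

lemma cosh_mult_cosh_add_diff: "cosh (a + b) * cosh (a - b) = (cosh a)\<^sup>2 + (sinh b :: real)\<^sup>2"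
  by (simp add: cosh_add cosh_diff power2_eq_square algebra_simps)
     (use cosh_square_eq[of a] cosh_square_eq[of b] in algebra)

text \<open>
  On unit complex numbers this is the subtraction formula for \<open>arctan\<close>: the polar angle of
  \<open>(cosh a, sinh b)\<close> is \<open>arctan (exp (a + b)) - arctan (exp (a - b))\<close>.  Twice this angle thereby
  splits into a function of \<open>a + b\<close> and a function of \<open>a - b\<close>.
\<close>

lemma kink_split_cosh_sinh:
  "kink 1 (a + b) * cnj (kink 1 (a - b)) * of_real ((cosh a)\<^sup>2 + (sinh b)\<^sup>2) = (Complex (cosh a) (sinh b))\<^sup>2"
proof -
  have "kink 1 (a + b) * cnj (kink 1 (a - b)) * of_real ((cosh a)\<^sup>2 + (sinh b)\<^sup>2)
     = Complex (- sinh (a + b)) 1 * cnj (Complex (- sinh (a - b)) 1)"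
    unfolding cosh_mult_cosh_add_diff[symmetric]
    by (simp add: complex_eq_iff kink_def tanh_def field_simps)
  also have "\<dots> = (Complex (cosh a) (sinh b))\<^sup>2"
    using cosh_square_eq[of a] cosh_square_eq[of b]
    by (auto simp add: complex_eq_iff sinh_add sinh_diff power2_eq_square) algebra
  finally show ?thesis .
qed

text \<open>
  The polar angle of \<open>(sinh a, cosh b)\<close> is the right angle minus that of \<open>(cosh b, sinh a)\<close>.
\<close>

lemma kink_split_sinh_cosh:
  "kink (- 1) (a + b) * cnj (kink 1 (a - b)) * of_real ((sinh a)\<^sup>2 + (cosh b)\<^sup>2) = (Complex (sinh a) (cosh b))\<^sup>2"
proof -
  have eq: "(sinh a)\<^sup>2 + (cosh b)\<^sup>2 = cosh (a + b) * cosh (a - b)"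
    using cosh_square_eq[of a] cosh_square_eq[of b] by (simp add: cosh_mult_cosh_add_diff)
  have "kink (- 1) (a + b) * cnj (kink 1 (a - b)) * of_real ((sinh a)\<^sup>2 + (cosh b)\<^sup>2)
     = Complex (- sinh (a + b)) (- 1) * cnj (Complex (- sinh (a - b)) 1)"
    unfolding eq
    by (simp add: complex_eq_iff kink_def tanh_def field_simps)
  also have "\<dots> = (Complex (sinh a) (cosh b))\<^sup>2"
    using cosh_square_eq[of a] cosh_square_eq[of b]
    by (auto simp add: complex_eq_iff sinh_add sinh_diff power2_eq_square) algebra
  finally show ?thesis .
qed

text \<open>
  For exponential functions the slope of \<open>(x, y)\<close> is itself an exponential, so a single kink is
  enough.
\<close>

lemma kink_of_ratio:
  assumes "y = \<sigma> * exp m * x" "\<sigma>\<^sup>2 = 1"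
  shows "kink \<sigma> m * of_real (x\<^sup>2 + y\<^sup>2) = (Complex x y)\<^sup>2"
proof -
  have e: "1 + (exp m)\<^sup>2 = 2 * exp m * cosh m" "(exp m)\<^sup>2 - 1 = 2 * exp m * sinh m"
    by (simp_all add: cosh_def sinh_def exp_minus field_simps power2_eq_square)
  then have "tanh m * (1 + (exp m)\<^sup>2) = (exp m)\<^sup>2 - 1" "(1 + (exp m)\<^sup>2) / cosh m = 2 * exp m"
    by (simp_all add: tanh_def)
  moreover have y: "y\<^sup>2 = (exp m)\<^sup>2 * x\<^sup>2"
    using assms by (simp add: power_mult_distrib)
  then have xy: "x\<^sup>2 + y\<^sup>2 = (1 + (exp m)\<^sup>2) * x\<^sup>2" by (simp add: algebra_simps)
  ultimately have "tanh m * (x\<^sup>2 + y\<^sup>2) = ((exp m)\<^sup>2 - 1) * x\<^sup>2"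
      "\<sigma> / cosh m * (x\<^sup>2 + y\<^sup>2) = 2 * exp m * (\<sigma> * x\<^sup>2)"
    by (metis mult.assoc, metis xy mult.assoc mult.commute times_divide_eq_left)
  then have "tanh m * (x\<^sup>2 + y\<^sup>2) = y\<^sup>2 - x\<^sup>2" "\<sigma> / cosh m * (x\<^sup>2 + y\<^sup>2) = 2 * x * y"
    using assms(1) y by (simp_all add: algebra_simps power2_eq_square)
  then show ?thesis
    by (simp add: kink_def complex_eq_iff power2_eq_square)
qed

section \<open>The Ribaucour transform as a reflection of the torus\<close>

definition circle1 :: "real \<Rightarrow> real ^ 4" where
  "circle1 a = vector [cos a, sin a, 0, 0]"

definition tangent1 :: "real \<Rightarrow> real ^ 4" where
  "tangent1 a = vector [- sin a, cos a, 0, 0]"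

definition circle2 :: "real \<Rightarrow> real ^ 4" where
  "circle2 a = vector [0, 0, cos a, sin a]"

definition tangent2 :: "real \<Rightarrow> real ^ 4" where
  "tangent2 a = vector [0, 0, - sin a, cos a]"

lemmas frame_defs = circle1_def tangent1_def circle2_def tangent2_def

lemma vector_4_axis:
  "(vector [w, x, y, z] :: real ^ 4) =
     w *\<^sub>R axis 1 1 + x *\<^sub>R axis 2 1 + y *\<^sub>R axis 3 1 + z *\<^sub>R axis 4 1"
  by (simp add: vec_eq_iff forall_4 axis_def)

lemma inner_4: "(v :: real ^ 4) \<bullet> w = v $ 1 * w $ 1 + v $ 2 * w $ 2 + v $ 3 * w $ 3 + v $ 4 * w $ 4"
  by (simp add: inner_vec_def sum_4)

lemma frame_derivatives:
  "(circle1 has_vector_derivative tangent1 a) (at a)"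
  "(tangent1 has_vector_derivative - circle1 a) (at a)"
  "(circle2 has_vector_derivative tangent2 a) (at a)"
  "(tangent2 has_vector_derivative - circle2 a) (at a)"
  unfolding frame_defs vector_4_axis has_vector_derivative_def
  by (auto intro!: derivative_eq_intros simp: fun_eq_iff algebra_simps)

lemma has_vector_derivative_rescale:
  assumes "\<And>a. (h has_vector_derivative h' a) (at a)"
  shows "((\<lambda>x. h (r * x)) has_vector_derivative r *\<^sub>R h' (r * x)) (at x)"
proof -
  have "((\<lambda>x. r * x) has_vector_derivative r) (at x)"
    by (auto intro!: derivative_eq_intros)
  from vector_diff_chain_at[OF this assms] show ?thesis by (simp add: o_def)
qed

lemma has_derivative_fst_snd:
  fixes h :: "real \<Rightarrow> 'b::real_normed_vector"
  shows "(h has_vector_derivative d) (at (fst u)) \<Longrightarrow>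
      ((\<lambda>u::real \<times> real. h (fst u)) has_derivative (\<lambda>v. fst v *\<^sub>R d)) (at u)"
    and "(h has_vector_derivative d) (at (snd u)) \<Longrightarrow>
      ((\<lambda>u::real \<times> real. h (snd u)) has_derivative (\<lambda>v. snd v *\<^sub>R d)) (at u)"
  unfolding has_vector_derivative_def
  by (erule has_derivative_compose[rotated], rule has_derivative_fst[OF has_derivative_ident])
     (erule has_derivative_compose[rotated], rule has_derivative_snd[OF has_derivative_ident])

lemma frame_orthonormal [simp]:
  "circle1 a \<bullet> circle1 a = 1" "circle2 b \<bullet> circle2 b = 1"
  "tangent1 a \<bullet> tangent1 a = 1" "tangent2 b \<bullet> tangent2 b = 1"
  "circle1 a \<bullet> tangent1 a = 0" "tangent1 a \<bullet> circle1 a = 0"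
  "circle2 b \<bullet> tangent2 b = 0" "tangent2 b \<bullet> circle2 b = 0"
  "circle1 a \<bullet> circle2 b = 0" "circle2 b \<bullet> circle1 a = 0"
  "circle1 a \<bullet> tangent2 b = 0" "tangent2 b \<bullet> circle1 a = 0"
  "tangent1 a \<bullet> circle2 b = 0" "circle2 b \<bullet> tangent1 a = 0"
  "tangent1 a \<bullet> tangent2 b = 0" "tangent2 b \<bullet> tangent1 a = 0"
  by (simp_all add: inner_4 frame_defs flip: power2_eq_square)

text \<open>
  The hypothesis \<open>energy\<close> fixes the constant in the first integrals of the two linear equations;
  it says that the vector \<open>eta\<close> below has squared length \<open>S\<close>.
\<close>

locale flat_torus_ribaucour =
  fixes r1 r2 c :: real and f g f' g' :: "real \<Rightarrow> real"
  assumes r1: "r1 > 0" and r2: "r2 > 0" and r12: "r1\<^sup>2 + r2\<^sup>2 = 1" and c: "c > 0"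
    and f: "\<And>x. (f has_real_derivative f' x) (at x)"
    and f': "\<And>x. (f' has_real_derivative c * r2\<^sup>2 * f x) (at x)"
    and g: "\<And>y. (g has_real_derivative g' y) (at y)"
    and g': "\<And>y. (g' has_real_derivative c * r1\<^sup>2 * g y) (at y)"
    and energy: "\<And>x y. (f' x)\<^sup>2 + (g' y)\<^sup>2 = c * (r2\<^sup>2 * (f x)\<^sup>2 + r1\<^sup>2 * (g y)\<^sup>2)"
    and nonzero: "\<And>x y. f x \<noteq> 0 \<or> g y \<noteq> 0"
begin

text \<open>
  \<open>Q\<close> is \<open>S / (1 + c)\<close>, the vector \<open>eta\<close> is normal to the reflecting hyperplane, \<open>coef\<close> is
  \<open>2 \<Omega> / S\<close>, and \<open>reflected1\<close>, \<open>reflected2\<close> are the images of the tangent vectors of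
  the torus under the reflection.  Up to the constant \<open>r1 r2\<close>, the numerators of \<open>stretch1\<close>
  and \<open>stretch2\<close> are the two factors that define \<open>V_dom\<close>.
\<close>

definition Q :: "real \<times> real \<Rightarrow> real" where
  "Q u = r2\<^sup>2 * (f (fst u))\<^sup>2 + r1\<^sup>2 * (g (snd u))\<^sup>2"

definition eta1 :: "real \<Rightarrow> real ^ 4" where
  "eta1 x = (r2 * f x) *\<^sub>R circle1 (r2 * x) + f' x *\<^sub>R tangent1 (r2 * x)"

definition eta2 :: "real \<Rightarrow> real ^ 4" where
  "eta2 y = (r1 * g y) *\<^sub>R circle2 (r1 * y) + g' y *\<^sub>R tangent2 (r1 * y)"

definition eta :: "real \<times> real \<Rightarrow> real ^ 4" where
  "eta u = eta1 (fst u) + eta2 (snd u)"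

definition torus :: "real \<times> real \<Rightarrow> real ^ 4" where
  "torus u = r1 *\<^sub>R circle1 (r2 * fst u) + r2 *\<^sub>R circle2 (r1 * snd u)"

definition coef :: "real \<times> real \<Rightarrow> real" where
  "coef u = 2 * r1 * r2 * (f (fst u) + g (snd u)) / ((1 + c) * Q u)"

definition stretch1 :: "real \<times> real \<Rightarrow> real" where
  "stretch1 u = r1 * r2 * (r1\<^sup>2 * (g (snd u))\<^sup>2 - r2\<^sup>2 * (f (fst u))\<^sup>2
                       - 2 * r2\<^sup>2 * f (fst u) * g (snd u)) / Q u"

definition stretch2 :: "real \<times> real \<Rightarrow> real" where
  "stretch2 u = r1 * r2 * (r2\<^sup>2 * (f (fst u))\<^sup>2 - r1\<^sup>2 * (g (snd u))\<^sup>2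
                       - 2 * r1\<^sup>2 * f (fst u) * g (snd u)) / Q u"

definition reflected1 :: "real \<times> real \<Rightarrow> real ^ 4" where
  "reflected1 u = tangent1 (r2 * fst u) - (2 * f' (fst u) / ((1 + c) * Q u)) *\<^sub>R eta u"

definition reflected2 :: "real \<times> real \<Rightarrow> real ^ 4" where
  "reflected2 u = tangent2 (r1 * snd u) - (2 * g' (snd u) / ((1 + c) * Q u)) *\<^sub>R eta u"

lemma Q_pos: "Q u > 0"
proof -
  have "(r2 * f (fst u))\<^sup>2 + (r1 * g (snd u))\<^sup>2 > 0"
    using nonzero[of "fst u" "snd u"] r1 r2 by (simp add: sum_power2_gt_zero_iff)
  then show ?thesis by (simp add: Q_def power_mult_distrib)
qed

lemma deriv_eqs: "deriv f x = f' x" "deriv g y = g' y"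
  using f g by (auto intro: DERIV_imp_deriv)

lemma Omega_W_sq: "(Omega_fun r1 r2 f g u)\<^sup>2 + (W_fun r1 r2 f g u)\<^sup>2 = Q u"
proof -
  obtain x y where u: "u = (x, y)" by fastforce
  have "(r1 * r2 * (f x + g y))\<^sup>2 + (r2\<^sup>2 * f x - r1\<^sup>2 * g y)\<^sup>2
      = (r1\<^sup>2 + r2\<^sup>2) * (r2\<^sup>2 * (f x)\<^sup>2 + r1\<^sup>2 * (g y)\<^sup>2)" by algebra
  then show ?thesis by (simp add: u Omega_fun_def W_fun_def Q_def r12)
qed

text \<open>
  The relation \<open>r1\<^sup>2 + r2\<^sup>2 = 1\<close> turns the coefficients \<open>r1 \<Omega> + r2 W\<close> and \<open>r2 \<Omega> - r1 W\<close> of the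
  two circles into \<open>r2 f\<close> and \<open>r1 g\<close>.
\<close>

lemma X_tilde_eq: "X_tilde r1 r2 c f g u = torus u - coef u *\<^sub>R eta u"
proof -
  obtain x y where u: "u = (x, y)" by fastforce
  define Om W where "Om = Omega_fun r1 r2 f g u" and "W = W_fun r1 r2 f g u"
  define S where "S = (1 + c) * Q u"
  have "S > 0" using Q_pos c by (simp add: S_def)
  have S: "S_fun r1 r2 c f g u = S" by (simp add: S_fun_def S_def Omega_W_sq)
  have "r1 * Om + r2 * W = (r1\<^sup>2 + r2\<^sup>2) * (r2 * f x)" "r2 * Om - r1 * W = (r1\<^sup>2 + r2\<^sup>2) * (r1 * g y)"
    by (simp_all add: Om_def W_def u Omega_fun_def W_fun_def power2_eq_square algebra_simps)
  then have xy: "r2 * f x = r1 * Om + r2 * W" "r1 * g y = r2 * Om - r1 * W"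
    by (simp_all add: r12)
  have coef: "coef u = 2 * Om / S"
    by (simp add: coef_def Om_def Omega_fun_def S_def u mult.assoc)
  show ?thesis
    unfolding coef[unfolded u] X_tilde_def u eta_def eta1_def eta2_def torus_def xy fst_conv snd_conv deriv_eqs
      prod.case Let_def S[unfolded u] Om_def[unfolded u, symmetric] W_def[unfolded u, symmetric]
    using \<open>S > 0\<close>
    by (simp add: vec_eq_iff forall_4 frame_defs divide_simps)
       (simp add: power2_eq_square algebra_simps)
qed

text \<open>
  The circle components cancel, and \<open>f'' = c r2\<^sup>2 f\<close> collects the tangential ones: \<open>eta\<close> changes
  only in the directions of the torus tangents.
\<close>

lemma eta1_derivative:
  "(eta1 has_vector_derivative ((1 + c) * r2\<^sup>2 * f x) *\<^sub>R tangent1 (r2 * x)) (at x)"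
proof -
  have *: "((\<lambda>x. circle1 (r2 * x)) has_vector_derivative r2 *\<^sub>R tangent1 (r2 * x)) (at x)"
    "((\<lambda>x. tangent1 (r2 * x)) has_vector_derivative r2 *\<^sub>R (- circle1 (r2 * x))) (at x)"
    by (rule has_vector_derivative_rescale frame_derivatives)+
  show ?thesis
    unfolding eta1_def
    by (rule derivative_eq_intros * f f' refl)+
       (simp add: algebra_simps power2_eq_square)
qed

lemma eta2_derivative:
  "(eta2 has_vector_derivative ((1 + c) * r1\<^sup>2 * g y) *\<^sub>R tangent2 (r1 * y)) (at y)"
proof -
  have *: "((\<lambda>x. circle2 (r1 * x)) has_vector_derivative r1 *\<^sub>R tangent2 (r1 * x)) (at x)"
    "((\<lambda>x. tangent2 (r1 * x)) has_vector_derivative r1 *\<^sub>R (- circle2 (r1 * x))) (at x)" for x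
    by (rule has_vector_derivative_rescale frame_derivatives)+
  show ?thesis
    unfolding eta2_def
    by (rule derivative_eq_intros * g g' refl)+
       (simp add: algebra_simps power2_eq_square)
qed

lemma stretch1_alt: "stretch1 u = r1 * r2 - coef u * ((1 + c) * r2\<^sup>2 * f (fst u))"
  and stretch2_alt: "stretch2 u = r1 * r2 - coef u * ((1 + c) * r1\<^sup>2 * g (snd u))"
  using Q_pos[of u] c
  by (simp_all add: stretch1_def stretch2_def coef_def divide_simps)
     (simp_all add: Q_def power2_eq_square algebra_simps)

definition dX :: "real \<times> real \<Rightarrow> real \<times> real \<Rightarrow> real ^ 4" where
  "dX u v = (stretch1 u * fst v) *\<^sub>R reflected1 u + (stretch2 u * snd v) *\<^sub>R reflected2 u"

text \<open>
  The three terms of the product rule combine: the derivative of \<open>eta\<close> reduces the coefficient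
  \<open>r1 r2\<close> of the torus tangents to \<open>stretch1\<close> and \<open>stretch2\<close>, and the derivative of \<open>coef\<close>
  contains the same two factors, so the multiple of \<open>eta\<close> subtracted is the one that reflects the tangents.
\<close>

lemma X_tilde_has_derivative: "(X_tilde r1 r2 c f g has_derivative dX u) (at u)"
proof -
  define S where "S = (1 + c) * Q u"
  have S: "S > 0" using Q_pos c by (simp add: S_def)
  have circ: "((\<lambda>x. circle1 (r2 * x)) has_vector_derivative r2 *\<^sub>R tangent1 (r2 * x)) (at x)"
    "((\<lambda>x. circle2 (r1 * x)) has_vector_derivative r1 *\<^sub>R tangent2 (r1 * x)) (at x)" for x
    by (rule has_vector_derivative_rescale frame_derivatives)+
  have fg: "((\<lambda>u. f (fst u)) has_derivative (\<lambda>v. fst v * f' (fst u))) (at u)"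
    "((\<lambda>u. g (snd u)) has_derivative (\<lambda>v. snd v * g' (snd u))) (at u)"
    using has_derivative_fst_snd[OF f[unfolded has_real_derivative_iff_has_vector_derivative]]
      has_derivative_fst_snd[OF g[unfolded has_real_derivative_iff_has_vector_derivative]]
    by simp_all
  define dcoef where "dcoef v =
      fst v * (2 * f' (fst u) / S) * stretch1 u + snd v * (2 * g' (snd u) / S) * stretch2 u" for v
  have Q: "(Q has_derivative
      (\<lambda>v. 2 * r2\<^sup>2 * f (fst u) * f' (fst u) * fst v + 2 * r1\<^sup>2 * g (snd u) * g' (snd u) * snd v)) (at u)"
    unfolding Q_def by (rule derivative_eq_intros fg refl)+ (simp add: fun_eq_iff algebra_simps)
  have num: "coef u * S = 2 * r1 * r2 * (f (fst u) + g (snd u))"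
    using S unfolding coef_def S_def[symmetric] by simp
  have "(coef has_derivative (\<lambda>v. (2 * r1 * r2 * (fst v * f' (fst u) + snd v * g' (snd u)) * S
      - 2 * r1 * r2 * (f (fst u) + g (snd u)) * ((1 + c) * (2 * r2\<^sup>2 * f (fst u) * f' (fst u) * fst v
        + 2 * r1\<^sup>2 * g (snd u) * g' (snd u) * snd v))) / (S * S))) (at u)"
    unfolding coef_def S_def using S
    by (intro has_derivative_divide' has_derivative_mult_right has_derivative_add fg Q)
       (use Q_pos[of u] c in simp)
  moreover have "(2 * r1 * r2 * (fst v * f' (fst u) + snd v * g' (snd u)) * S
      - 2 * r1 * r2 * (f (fst u) + g (snd u)) * ((1 + c) * (2 * r2\<^sup>2 * f (fst u) * f' (fst u) * fst v
        + 2 * r1\<^sup>2 * g (snd u) * g' (snd u) * snd v))) / (S * S) = dcoef v" for v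
    unfolding num[symmetric] dcoef_def stretch1_alt stretch2_alt
    using S by (simp add: divide_simps) (simp add: algebra_simps)
  ultimately have coef: "(coef has_derivative dcoef) (at u)"
    by simp
  have eta: "(eta has_derivative (\<lambda>v. fst v *\<^sub>R ((1 + c) * r2\<^sup>2 * f (fst u)) *\<^sub>R tangent1 (r2 * fst u)
      + snd v *\<^sub>R ((1 + c) * r1\<^sup>2 * g (snd u)) *\<^sub>R tangent2 (r1 * snd u))) (at u)"
    unfolding eta_def
    by (intro has_derivative_add has_derivative_fst_snd eta1_derivative eta2_derivative)
  have torus: "(torus has_derivative (\<lambda>v. r1 *\<^sub>R (fst v *\<^sub>R (r2 *\<^sub>R tangent1 (r2 * fst u)))
     + r2 *\<^sub>R (snd v *\<^sub>R (r1 *\<^sub>R tangent2 (r1 * snd u))))) (at u)"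
    unfolding torus_def
    by (intro has_derivative_add has_derivative_scaleR_right has_derivative_fst_snd circ)
  have "X_tilde r1 r2 c f g = (\<lambda>u. torus u - coef u *\<^sub>R eta u)"
    by (simp add: fun_eq_iff X_tilde_eq)
  moreover have "((\<lambda>u. torus u - coef u *\<^sub>R eta u) has_derivative dX u) (at u)"
  proof (rule has_derivative_eq_rhs[OF has_derivative_diff[OF torus has_derivative_scaleR[OF coef eta]]], rule ext)
    fix v
    have "dX u v = (stretch1 u * fst v) *\<^sub>R tangent1 (r2 * fst u) + (stretch2 u * snd v) *\<^sub>R tangent2 (r1 * snd u)
        - dcoef v *\<^sub>R eta u"
      by (simp add: dX_def reflected1_def reflected2_def dcoef_def S_def algebra_simps)
    then show "r1 *\<^sub>R fst v *\<^sub>R r2 *\<^sub>R tangent1 (r2 * fst u) +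
         r2 *\<^sub>R snd v *\<^sub>R r1 *\<^sub>R tangent2 (r1 * snd u) -
         (coef u *\<^sub>R
          (fst v *\<^sub>R ((1 + c) * r2\<^sup>2 * f (fst u)) *\<^sub>R tangent1 (r2 * fst u) +
           snd v *\<^sub>R ((1 + c) * r1\<^sup>2 * g (snd u)) *\<^sub>R tangent2 (r1 * snd u)) +
          dcoef v *\<^sub>R eta u) = dX u v"
      by (simp add: stretch1_alt stretch2_alt algebra_simps)
  qed
  ultimately show ?thesis by simp
qed

text \<open>
  A reflection is an isometry, so \<open>reflected1\<close> and \<open>reflected2\<close> are orthonormal.
\<close>

lemma norm_dX: "(norm (dX u v))\<^sup>2 = (stretch1 u * fst v)\<^sup>2 + (stretch2 u * snd v)\<^sup>2"
proof -
  define S where "S = (1 + c) * Q u"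
  have S: "S > 0" using Q_pos c by (simp add: S_def)
  have ee: "eta u \<bullet> eta u = S"
    using energy[of "fst u" "snd u"]
    by (simp add: eta_def eta1_def eta2_def inner_add S_def Q_def algebra_simps power2_eq_square)
  have te: "eta u \<bullet> tangent1 (r2 * fst u) = f' (fst u)" "eta u \<bullet> tangent2 (r1 * snd u) = g' (snd u)"
    by (simp_all add: eta_def eta1_def eta2_def inner_add)
  have on: "reflected1 u \<bullet> reflected1 u = 1" "reflected2 u \<bullet> reflected2 u = 1" "reflected1 u \<bullet> reflected2 u = 0"
    using S unfolding reflected1_def reflected2_def S_def[symmetric]
    by (simp_all add: inner_diff te ee inner_commute[of "tangent1 _" "eta u"] inner_commute[of "tangent2 _" "eta u"])
  show ?thesis
    unfolding power2_norm_eq_inner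
    by (simp add: dX_def inner_add on inner_commute[of "reflected2 u" "reflected1 u"] power2_eq_square)
qed

lemma V_dom_iff: "u \<in> V_dom r1 r2 f g \<longleftrightarrow> stretch1 u \<noteq> 0 \<and> stretch2 u \<noteq> 0"
  using Q_pos[of u] r1 r2 by (auto simp: V_dom_def stretch1_def stretch2_def split: prod.splits)

lemma immersion_iff: "immersion_at (X_tilde r1 r2 c f g) u \<longleftrightarrow> u \<in> V_dom r1 r2 f g"
proof -
  have fd: "frechet_derivative (X_tilde r1 r2 c f g) (at u) = dX u"
    using X_tilde_has_derivative by (metis frechet_derivative_at)
  have "linear (dX u)" using X_tilde_has_derivative by (rule has_derivative_linear)
  then have "inj (dX u) \<longleftrightarrow> (\<forall>v. norm (dX u v) ^ 2 = 0 \<longrightarrow> v = 0)"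
    by (simp add: linear_injective_0)
  also have "\<dots> \<longleftrightarrow> stretch1 u \<noteq> 0 \<and> stretch2 u \<noteq> 0"
  proof safe
    assume *: "\<forall>v. (norm (dX u v))\<^sup>2 = 0 \<longrightarrow> v = 0"
    show False if "stretch1 u = 0" using *[rule_format, of "(1, 0)"] that by (simp add: norm_dX zero_prod_def)
    show False if "stretch2 u = 0" using *[rule_format, of "(0, 1)"] that by (simp add: norm_dX zero_prod_def)
  qed (auto simp: norm_dX sum_power2_eq_zero_iff prod_eq_iff)
  finally show ?thesis
    using X_tilde_has_derivative[of u] by (auto simp: immersion_at_def fd V_dom_iff differentiable_def)
qed

lemma open_V_dom: "open (V_dom r1 r2 f g)"
proof -
  have cont: "continuous_on UNIV f" "continuous_on UNIV g"
    using f g by (meson DERIV_isCont continuous_at_imp_continuous_on)+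
  have "continuous_on UNIV (\<lambda>u::real \<times> real. f (fst u))" "continuous_on UNIV (\<lambda>u::real \<times> real. g (snd u))"
    by (auto intro!: continuous_on_compose2[OF cont(1)] continuous_on_compose2[OF cont(2)] continuous_intros)
  then show ?thesis
    unfolding V_dom_def case_prod_unfold by (intro open_Collect_neq continuous_intros)
qed

lemma complete_surface_if_paths_infinite:
  assumes "divergent_paths_infinite (closure (V_dom r1 r2 f g)) (X_tilde r1 r2 c f g)"
  shows "complete_surface (V_dom r1 r2 f g) (X_tilde r1 r2 c f g)"
  unfolding complete_surface_def
proof (intro conjI ballI)
  show "X_tilde r1 r2 c f g differentiable at p" for p
    using X_tilde_has_derivative[of p] by (auto simp: differentiable_def)
qed (use assms open_V_dom in \<open>auto simp: immersion_iff frontier_def interior_open\<close>)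

section \<open>The developing map\<close>

text \<open>
  The number \<open>w\<close> has modulus 1 and argument \<open>\<psi> = 2 \<theta> - \<phi>\<close>, so the two stretch factors are
  \<open>- r2 cos \<psi>\<close> and \<open>- r1 sin \<psi>\<close>.
\<close>

lemma stretch_factors:
  assumes "w * of_real (Q u) = Complex r1 (- r2) * (Complex (r2 * f (fst u)) (r1 * g (snd u)))\<^sup>2"
  shows "r2 * Re w = - stretch1 u" "r1 * Im w = - stretch2 u"
proof -
  define x y where "x = r2 * f (fst u)" and "y = r1 * g (snd u)"
  have "stretch1 u * Q u = r1 * r2 * (r1\<^sup>2 * (g (snd u))\<^sup>2 - r2\<^sup>2 * (f (fst u))\<^sup>2
      - 2 * r2\<^sup>2 * f (fst u) * g (snd u))"
    "stretch2 u * Q u = r1 * r2 * (r2\<^sup>2 * (f (fst u))\<^sup>2 - r1\<^sup>2 * (g (snd u))\<^sup>2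
      - 2 * r1\<^sup>2 * f (fst u) * g (snd u))"
    using Q_pos[of u] by (simp_all add: stretch1_def stretch2_def)
  then have k: "stretch1 u * Q u = r2 * (r1 * (y\<^sup>2 - x\<^sup>2) - 2 * r2 * (x * y))"
    "stretch2 u * Q u = r1 * (r2 * (x\<^sup>2 - y\<^sup>2) - 2 * r1 * (x * y))"
    by (simp_all add: x_def y_def power2_eq_square algebra_simps)
  have "Re w * Q u = Re (Complex r1 (- r2) * (Complex x y)\<^sup>2)"
    "Im w * Q u = Im (Complex r1 (- r2) * (Complex x y)\<^sup>2)"
    unfolding x_def y_def assms[symmetric] by simp_all
  then have ReIm: "Re w * Q u = r1 * (x\<^sup>2 - y\<^sup>2) + 2 * r2 * (x * y)"
    "Im w * Q u = 2 * r1 * (x * y) - r2 * (x\<^sup>2 - y\<^sup>2)"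
    by (simp_all add: power2_eq_square)
  have eqs: "r2 * Re w * Q u = - stretch1 u * Q u" "r1 * Im w * Q u = - stretch2 u * Q u"
    unfolding mult_minus_left k mult.assoc[of _ "Re w"] mult.assoc[of _ "Im w"] ReIm
    by (simp_all add: algebra_simps)
  have nz: "Q u \<noteq> 0" using Q_pos[of u] by simp
  show "r2 * Re w = - stretch1 u" by (rule mult_right_cancel[OF nz, THEN iffD1, OF eqs(1)])
  show "r1 * Im w = - stretch2 u" by (rule mult_right_cancel[OF nz, THEN iffD1, OF eqs(2)])
qed

text \<open>
  The hypothesis \<open>split\<close> expresses that twice the polar angle of \<open>(r2 f, r1 g)\<close> is the argument
  of \<open>z1\<close> minus that of \<open>z2\<close>, where \<open>z1\<close> and \<open>z2\<close> depend on one characteristic coordinate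
  each.  Then \<open>D\<close> below develops the surface isometrically into the plane.
\<close>

lemma complete_if_angle_splits:
  assumes F: "straightening z1 F1" "straightening z2 F2"
    and split: "\<And>x y. z1 (sqrt c * (r2 * x + r1 * y)) * cnj (z2 (sqrt c * (r2 * x - r1 * y)))
        * of_real (Q (x, y)) = (Complex (r2 * f x) (r1 * g y))\<^sup>2"
  shows "complete_surface (V_dom r1 r2 f g) (X_tilde r1 r2 c f g)"
proof -
  define s t where "s = (\<lambda>u. sqrt c * (r2 * fst u + r1 * snd u))"
    and "t = (\<lambda>u. sqrt c * (r2 * fst u - r1 * snd u))"
  define \<rho> where "\<rho> = Complex r1 (- r2)"
  have \<rho>: "norm \<rho> = 1" using r12 by (simp add: \<rho>_def cmod_def)
  have norm_z: "norm (z1 a) = 1" "norm (z2 a) = 1" for a using F by (auto simp: straightening_def)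
  define D where "D u = (\<rho>\<^sup>2 * F1 (s u) + F2 (t u)) /\<^sub>R (2 * sqrt c)" for u
  define D' where "D' u v = (\<rho>\<^sup>2 * (s v *\<^sub>R (z1 (s u))\<^sup>2) + t v *\<^sub>R (z2 (t u))\<^sup>2) /\<^sub>R (2 * sqrt c)" for u v
  have st: "(s has_derivative s) (at u)" "(t has_derivative t) (at u)" for u
    unfolding s_def t_def by (auto intro!: derivative_eq_intros)
  have dF: "(F1 has_derivative (\<lambda>h. h *\<^sub>R (z1 a)\<^sup>2)) (at a)"
    "(F2 has_derivative (\<lambda>h. h *\<^sub>R (z2 a)\<^sup>2)) (at a)" for a
    using F by (auto simp: straightening_def has_vector_derivative_def)
  have chain: "((\<lambda>u. F1 (s u)) has_derivative (\<lambda>v. s v *\<^sub>R (z1 (s u))\<^sup>2)) (at u)"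
    "((\<lambda>u. F2 (t u)) has_derivative (\<lambda>v. t v *\<^sub>R (z2 (t u))\<^sup>2)) (at u)" for u
    by (rule has_derivative_compose[OF st(1) dF(1)], rule has_derivative_compose[OF st(2) dF(2)])
  have D: "(D has_derivative D' u) (at u)" for u
    unfolding D_def D'_def
    by (intro has_derivative_scaleR_right has_derivative_add has_derivative_mult_right chain)
  have cont_z: "continuous_on UNIV z1" "continuous_on UNIV z2"
    using F by (auto simp: straightening_def)
  have "continuous_on UNIV (\<lambda>(u, v). D' u v)"
    unfolding D'_def case_prod_unfold s_def t_def
    by (intro continuous_intros continuous_on_compose2[OF cont_z(1)] continuous_on_compose2[OF cont_z(2)]) auto
  moreover have "norm (D' u v) \<le> norm (dX u v)" for u v
  proof -
    define Z1 Z2 where "Z1 = z1 (s u)" and "Z2 = z2 (t u)"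
    define w where "w = \<rho> * Z1 * cnj Z2"
    have "s v + t v = 2 * sqrt c * (r2 * fst v)" "s v - t v = 2 * sqrt c * (r1 * snd v)"
      by (simp_all add: s_def t_def algebra_simps)
    moreover have "(norm (\<rho>\<^sup>2 * (s v *\<^sub>R Z1\<^sup>2) + t v *\<^sub>R Z2\<^sup>2))\<^sup>2
        = ((s v + t v) * Re w)\<^sup>2 + ((s v - t v) * Im w)\<^sup>2"
      unfolding w_def by (rule norm_chebyshev_form) (simp_all add: \<rho> norm_z Z1_def Z2_def)
    ultimately have "(norm (\<rho>\<^sup>2 * (s v *\<^sub>R Z1\<^sup>2) + t v *\<^sub>R Z2\<^sup>2))\<^sup>2
        = (2 * sqrt c * (r2 * fst v) * Re w)\<^sup>2 + (2 * sqrt c * (r1 * snd v) * Im w)\<^sup>2"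
      by (simp only:)
    also have "\<dots> = (2 * sqrt c)\<^sup>2 * ((r2 * Re w * fst v)\<^sup>2 + (r1 * Im w * snd v)\<^sup>2)"
      by (simp add: power_mult_distrib algebra_simps)
    finally have E: "(norm (\<rho>\<^sup>2 * (s v *\<^sub>R Z1\<^sup>2) + t v *\<^sub>R Z2\<^sup>2))\<^sup>2
        = (2 * sqrt c)\<^sup>2 * ((r2 * Re w * fst v)\<^sup>2 + (r1 * Im w * snd v)\<^sup>2)" .
    have "norm (D' u v) = norm (\<rho>\<^sup>2 * (s v *\<^sub>R Z1\<^sup>2) + t v *\<^sub>R Z2\<^sup>2) / (2 * sqrt c)"
    proof -
      have "norm (E /\<^sub>R k) = norm E / k" if "k > 0" for E :: complex and k
        using that by (simp add: divide_inverse)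
      then show ?thesis using c unfolding D'_def Z1_def Z2_def by simp
    qed
    then have sq: "(norm (D' u v))\<^sup>2 = (r2 * Re w * fst v)\<^sup>2 + (r1 * Im w * snd v)\<^sup>2"
      using c by (simp only: power_divide E) simp
    have "w * of_real (Q u) = \<rho> * (Complex (r2 * f (fst u)) (r1 * g (snd u)))\<^sup>2"
      using split[of "fst u" "snd u"] by (simp add: w_def Z1_def Z2_def s_def t_def mult.assoc)
    then have "r2 * Re w = - stretch1 u" "r1 * Im w = - stretch2 u"
      unfolding \<rho>_def by (rule stretch_factors)+
    with sq norm_dX have "(norm (D' u v))\<^sup>2 = (norm (dX u v))\<^sup>2" by simp
    then show ?thesis by simp
  qed
  \<comment> \<open>Properness: up to a bounded error \<open>2 sqrt c D\<close> is the linear map \<open>\<rho>\<^sup>2 s + t\<close>.  Its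
      imaginary part controls \<open>s\<close> because \<open>\<rho>\<^sup>2\<close> has imaginary part \<open>- 2 r1 r2\<close>; then \<open>t\<close> is
      controlled as well.\<close>
  moreover have "bounded {u. norm (D u) \<le> R}" for R
  proof -
    obtain C1 C2 where C: "\<And>a. norm (F1 a - of_real a) \<le> C1" "\<And>a. norm (F2 a - of_real a) \<le> C2"
      using F unfolding straightening_def bounded_iff by blast
    define B where "B = 2 * sqrt c * R + C1 + C2"
    define B' where "B' = B / (2 * r1 * r2)"
    have st: "\<bar>s u\<bar> \<le> B'" "\<bar>t u\<bar> \<le> B + B'" if "norm (D u) \<le> R" for u
    proof -
      define e where "e = \<rho>\<^sup>2 * (F1 (s u) - of_real (s u)) + (F2 (t u) - of_real (t u))"
      have "norm e \<le> norm (\<rho>\<^sup>2 * (F1 (s u) - of_real (s u))) + norm (F2 (t u) - of_real (t u))"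
        unfolding e_def by (rule norm_triangle_ineq)
      also have "\<dots> \<le> C1 + C2"
        using C by (intro add_mono) (simp_all add: norm_mult norm_power \<rho>)
      finally have e: "norm e \<le> C1 + C2" .
      have "norm ((2 * sqrt c) *\<^sub>R D u) \<le> 2 * sqrt c * R"
        using that c by (simp add: mult_left_mono)
      moreover have "(2 * sqrt c) *\<^sub>R D u = \<rho>\<^sup>2 * s u + t u + e"
        using c by (simp add: D_def e_def algebra_simps)
      moreover have "norm (\<rho>\<^sup>2 * s u + t u) \<le> norm (\<rho>\<^sup>2 * s u + t u + e) + norm e"
        using norm_triangle_ineq4[of "\<rho>\<^sup>2 * s u + t u + e" e] by simp
      ultimately have n: "norm (\<rho>\<^sup>2 * s u + t u) \<le> B"
        using e by (simp add: B_def)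
      have "Im (\<rho>\<^sup>2 * s u + t u) = - (2 * r1 * r2 * s u)"
        by (simp add: \<rho>_def power2_eq_square)
      then have "2 * r1 * r2 * \<bar>s u\<bar> \<le> B"
        using abs_Im_le_cmod[of "\<rho>\<^sup>2 * s u + t u"] n r1 r2 by (simp add: abs_mult)
      then show s: "\<bar>s u\<bar> \<le> B'"
        using r1 r2 by (simp add: B'_def field_simps)
      have "\<bar>t u\<bar> \<le> norm (\<rho>\<^sup>2 * s u + t u) + norm (\<rho>\<^sup>2 * s u)"
        using norm_triangle_ineq4[of "\<rho>\<^sup>2 * s u + t u" "\<rho>\<^sup>2 * s u"] by simp
      then show "\<bar>t u\<bar> \<le> B + B'"
        using n s by (simp add: norm_mult norm_power \<rho>)
    qed
    define B2 where "B2 = (B + 2 * B') / (2 * sqrt c)"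
    have "norm u \<le> B2 / r2 + B2 / r1" if "norm (D u) \<le> R" for u
    proof -
      have "2 * sqrt c * (r2 * fst u) = s u + t u" "2 * sqrt c * (r1 * snd u) = s u - t u"
        by (simp_all add: s_def t_def algebra_simps)
      then have "fst u = (s u + t u) / (2 * sqrt c) / r2" "snd u = (s u - t u) / (2 * sqrt c) / r1"
        using r1 r2 c by (simp_all add: field_simps)
      then have "\<bar>fst u\<bar> \<le> B2 / r2" "\<bar>snd u\<bar> \<le> B2 / r1"
        using st[OF that] r1 r2 c unfolding B2_def
        by (simp_all add: abs_divide divide_right_mono)
      then show ?thesis
        using sqrt_sum_squares_le_sum_abs[of "fst u" "snd u"] by (simp add: norm_prod_def)
    qed
    then show ?thesis unfolding bounded_iff by blast
  qed
  ultimately have "divergent_paths_infinite (closure (V_dom r1 r2 f g)) (X_tilde r1 r2 c f g)"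
    using X_tilde_has_derivative D by (intro divergent_paths_infinite_if_proper_short_map) auto
  then show ?thesis by (rule complete_surface_if_paths_infinite)
qed

end

lemma complete_cosh_sinh:
  assumes "r1 > 0" "r2 > 0" "r1\<^sup>2 + r2\<^sup>2 = 1" "c > 0"
  defines "f \<equiv> \<lambda>x. cosh (r2 * sqrt c * x)" and "g \<equiv> \<lambda>y. r2 / r1 * sinh (r1 * sqrt c * y)"
  shows "complete_surface (V_dom r1 r2 f g) (X_tilde r1 r2 c f g)"
proof -
  interpret flat_torus_ribaucour r1 r2 c f g
    "\<lambda>x. r2 * sqrt c * sinh (r2 * sqrt c * x)" "\<lambda>y. r2 * sqrt c * cosh (r1 * sqrt c * y)"
  proof unfold_locales
    show "(r2 * sqrt c * sinh (r2 * sqrt c * x))\<^sup>2 + (r2 * sqrt c * cosh (r1 * sqrt c * y))\<^sup>2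
        = c * (r2\<^sup>2 * (f x)\<^sup>2 + r1\<^sup>2 * (g y)\<^sup>2)" for x y
    proof -
      have "r1\<^sup>2 * (g y)\<^sup>2 = r2\<^sup>2 * (sinh (r1 * sqrt c * y))\<^sup>2"
        using \<open>r1 > 0\<close> by (simp add: g_def power_mult_distrib power_divide)
      then show ?thesis
        using \<open>c > 0\<close> by (simp add: f_def power_mult_distrib cosh_square_eq algebra_simps)
    qed
  qed (use assms in \<open>auto intro!: derivative_eq_intros simp: power2_eq_square\<close>)
  show ?thesis
  proof (rule complete_if_angle_splits)
    show "straightening (kink 1) (kink_curve 1)"
      "straightening (kink 1) (kink_curve 1)"
      using straightening_kink[of _ 1 0] by simp_all
    fix x y
    define a b where "a = r2 * sqrt c * x" and "b = r1 * sqrt c * y"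
    have xy: "r2 * f x = r2 * cosh a" "r1 * g y = r2 * sinh b"
      using assms by (simp_all add: f_def g_def a_def b_def)
    have "Q (x, y) = r2\<^sup>2 * ((cosh a)\<^sup>2 + (sinh b)\<^sup>2)"
      unfolding Q_def fst_conv snd_conv power_mult_distrib[symmetric] xy
      by (simp add: power_mult_distrib distrib_left)
    moreover have "Complex (r2 * f x) (r1 * g y) = of_real r2 * Complex (cosh a) (sinh b)"
      unfolding xy by (simp add: complex_eq_iff)
    moreover have "sqrt c * (r2 * x + r1 * y) = a + b" "sqrt c * (r2 * x - r1 * y) = a - b"
      by (simp_all add: a_def b_def algebra_simps)
    ultimately show "kink 1 (sqrt c * (r2 * x + r1 * y)) *
         cnj (kink 1 (sqrt c * (r2 * x - r1 * y))) * of_real (Q (x, y))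
       = (Complex (r2 * f x) (r1 * g y))\<^sup>2"
      using arg_cong[OF kink_split_cosh_sinh[of a b], of "\<lambda>z. of_real (r2\<^sup>2) * z"]
      by (simp only: power_mult_distrib of_real_mult of_real_power mult_ac mult_1 add_0_right)
  qed
qed

lemma complete_sinh_cosh:
  assumes "r1 > 0" "r2 > 0" "r1\<^sup>2 + r2\<^sup>2 = 1" "c > 0"
  defines "f \<equiv> \<lambda>x. sinh (r2 * sqrt c * x)" and "g \<equiv> \<lambda>y. r2 / r1 * cosh (r1 * sqrt c * y)"
  shows "complete_surface (V_dom r1 r2 f g) (X_tilde r1 r2 c f g)"
proof -
  interpret flat_torus_ribaucour r1 r2 c f g
    "\<lambda>x. r2 * sqrt c * cosh (r2 * sqrt c * x)" "\<lambda>y. r2 * sqrt c * sinh (r1 * sqrt c * y)"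
  proof unfold_locales
    show "(r2 * sqrt c * cosh (r2 * sqrt c * x))\<^sup>2 + (r2 * sqrt c * sinh (r1 * sqrt c * y))\<^sup>2
        = c * (r2\<^sup>2 * (f x)\<^sup>2 + r1\<^sup>2 * (g y)\<^sup>2)" for x y
    proof -
      have "r1\<^sup>2 * (g y)\<^sup>2 = r2\<^sup>2 * (cosh (r1 * sqrt c * y))\<^sup>2"
        using \<open>r1 > 0\<close> by (simp add: g_def power_mult_distrib power_divide)
      then show ?thesis
        using \<open>c > 0\<close> by (simp add: f_def power_mult_distrib cosh_square_eq algebra_simps)
    qed
  qed (use assms in \<open>auto intro!: derivative_eq_intros simp: power2_eq_square\<close>)
  show ?thesis
  proof (rule complete_if_angle_splits)
    show "straightening (kink (- 1)) (kink_curve (- 1))"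
      "straightening (kink 1) (kink_curve 1)"
      using straightening_kink[of _ 1 0] by simp_all
    fix x y
    define a b where "a = r2 * sqrt c * x" and "b = r1 * sqrt c * y"
    have xy: "r2 * f x = r2 * sinh a" "r1 * g y = r2 * cosh b"
      using assms by (simp_all add: f_def g_def a_def b_def)
    have "Q (x, y) = r2\<^sup>2 * ((sinh a)\<^sup>2 + (cosh b)\<^sup>2)"
      unfolding Q_def fst_conv snd_conv power_mult_distrib[symmetric] xy
      by (simp add: power_mult_distrib distrib_left)
    moreover have "Complex (r2 * f x) (r1 * g y) = of_real r2 * Complex (sinh a) (cosh b)"
      unfolding xy by (simp add: complex_eq_iff)
    moreover have "sqrt c * (r2 * x + r1 * y) = a + b" "sqrt c * (r2 * x - r1 * y) = a - b"
      by (simp_all add: a_def b_def algebra_simps)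
    ultimately show "kink (- 1) (sqrt c * (r2 * x + r1 * y)) *
         cnj (kink 1 (sqrt c * (r2 * x - r1 * y))) * of_real (Q (x, y))
       = (Complex (r2 * f x) (r1 * g y))\<^sup>2"
      using arg_cong[OF kink_split_sinh_cosh[of a b], of "\<lambda>z. of_real (r2\<^sup>2) * z"]
      by (simp only: power_mult_distrib of_real_mult of_real_power mult_ac mult_1 add_0_right)
  qed
qed

lemma complete_exp_exp:
  assumes "r1 > 0" "r2 > 0" "r1\<^sup>2 + r2\<^sup>2 = 1" "c > 0"
    and nz: "a1 \<noteq> 0" "b1 \<noteq> 0" and eps: "\<epsilon>1\<^sup>2 = 1" "\<epsilon>2\<^sup>2 = 1"
  defines "f \<equiv> \<lambda>x. a1 * exp (\<epsilon>1 * r2 * sqrt c * x)" and "g \<equiv> \<lambda>y. b1 * exp (\<epsilon>2 * r1 * sqrt c * y)"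
  shows "complete_surface (V_dom r1 r2 f g) (X_tilde r1 r2 c f g)"
proof -
  have sq: "(\<epsilon>1 * r2 * sqrt c)\<^sup>2 = c * r2\<^sup>2" "(\<epsilon>2 * r1 * sqrt c)\<^sup>2 = c * r1\<^sup>2"
    using eps \<open>c > 0\<close> by (simp_all add: power_mult_distrib)
  have f: "(f has_real_derivative \<epsilon>1 * r2 * sqrt c * f x) (at x)" for x
    unfolding f_def by (auto intro!: derivative_eq_intros)
  have g: "(g has_real_derivative \<epsilon>2 * r1 * sqrt c * g y) (at y)" for y
    unfolding g_def by (auto intro!: derivative_eq_intros)
  interpret flat_torus_ribaucour r1 r2 c f g
    "\<lambda>x. \<epsilon>1 * r2 * sqrt c * f x" "\<lambda>y. \<epsilon>2 * r1 * sqrt c * g y"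
  proof unfold_locales
    show "((\<lambda>x. \<epsilon>1 * r2 * sqrt c * f x) has_real_derivative c * r2\<^sup>2 * f x) (at x)" for x
    proof -
      have "\<epsilon>1 * r2 * sqrt c * (\<epsilon>1 * r2 * sqrt c * f x) = c * r2\<^sup>2 * f x"
        using sq(1) by (metis power2_eq_square mult.assoc)
      then show ?thesis
        using DERIV_cmult[OF f, of "\<epsilon>1 * r2 * sqrt c" x] by (simp only:)
    qed
    show "((\<lambda>y. \<epsilon>2 * r1 * sqrt c * g y) has_real_derivative c * r1\<^sup>2 * g y) (at y)" for y
    proof -
      have "\<epsilon>2 * r1 * sqrt c * (\<epsilon>2 * r1 * sqrt c * g y) = c * r1\<^sup>2 * g y"
        using sq(2) by (metis power2_eq_square mult.assoc)
      then show ?thesis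
        using DERIV_cmult[OF g, of "\<epsilon>2 * r1 * sqrt c" y] by (simp only:)
    qed
    show "(\<epsilon>1 * r2 * sqrt c * f x)\<^sup>2 + (\<epsilon>2 * r1 * sqrt c * g y)\<^sup>2
        = c * (r2\<^sup>2 * (f x)\<^sup>2 + r1\<^sup>2 * (g y)\<^sup>2)" for x y
      unfolding power_mult_distrib[of _ "f x"] power_mult_distrib[of _ "g y"] sq
      by (simp add: algebra_simps)
    show "f x \<noteq> 0 \<or> g y \<noteq> 0" for x y using nz by (simp add: f_def)
  qed (use assms f g in auto)
  \<comment> \<open>\<open>K\<close> is the slope of \<open>(r2 f, r1 g)\<close> at the origin; its sign chooses between the two kinks.\<close>
  define K where "K = r1 * b1 / (r2 * a1)"
  define k where "k = ln \<bar>K\<bar>"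
  define \<sigma> where "\<sigma> = sgn K"
  have "K \<noteq> 0" using assms by (simp add: K_def)
  then have \<sigma>: "\<sigma>\<^sup>2 = 1" and K: "K = \<sigma> * exp k"
    by (simp_all add: \<sigma>_def k_def sgn_if)
  have ratio: "kink \<sigma> (k + \<epsilon>2 * (r1 * sqrt c * y) - \<epsilon>1 * (r2 * sqrt c * x)) * of_real (Q (x, y))
      = (Complex (r2 * f x) (r1 * g y))\<^sup>2" for x y
  proof -
    have "r1 * g y = \<sigma> * exp (k + \<epsilon>2 * (r1 * sqrt c * y) - \<epsilon>1 * (r2 * sqrt c * x)) * (r2 * f x)"
    proof -
      have "r1 * b1 = \<sigma> * exp k * (r2 * a1)" using K assms by (simp add: K_def field_simps)
      then show ?thesis by (simp add: f_def g_def exp_diff exp_add mult_ac)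
    qed
    from kink_of_ratio[OF this \<sigma>] show ?thesis by (simp add: Q_def power_mult_distrib)
  qed
  \<comment> \<open>The exponent is a function of \<open>r2 u1 - r1 u2\<close> alone or of \<open>r2 u1 + r1 u2\<close> alone, so one of
      the two curves is the straight line.\<close>
  consider "\<epsilon>1 = \<epsilon>2" | "\<epsilon>1 = - \<epsilon>2" using eps by (metis power2_eq_iff)
  then show ?thesis
  proof cases
    case 1
    show ?thesis
    proof (rule complete_if_angle_splits[OF straightening_line])
      show "straightening (\<lambda>s. kink (- \<sigma>) (- \<epsilon>2 * s + k)) (\<lambda>s. (- \<epsilon>2) *\<^sub>R kink_curve (- \<sigma>) (- \<epsilon>2 * s + k))"
        using \<sigma> eps by (intro straightening_kink) auto
      have cnj: "cnj (kink (- \<sigma>) m) = kink \<sigma> m" for m by (simp add: kink_def complex_eq_iff)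
      show "1 * cnj (kink (- \<sigma>) (- \<epsilon>2 * (sqrt c * (r2 * x - r1 * y)) + k)) * of_real (Q (x, y))
          = (Complex (r2 * f x) (r1 * g y))\<^sup>2" for x y
        using ratio[where x=x and y=y] unfolding cnj 1 by (simp add: algebra_simps)
    qed
  next
    case 2
    show ?thesis
    proof (rule complete_if_angle_splits[OF _ straightening_line])
      show "straightening (\<lambda>s. kink \<sigma> (\<epsilon>2 * s + k)) (\<lambda>s. \<epsilon>2 *\<^sub>R kink_curve \<sigma> (\<epsilon>2 * s + k))"
        using \<sigma> eps by (intro straightening_kink) auto
      show "kink \<sigma> (\<epsilon>2 * (sqrt c * (r2 * x + r1 * y)) + k) * cnj 1 * of_real (Q (x, y))
          = (Complex (r2 * f x) (r1 * g y))\<^sup>2" for x y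
        using ratio[where x=x and y=y] unfolding 2 by (simp add: algebra_simps)
    qed
  qed
qed

theorem proposition3p3:
  fixes r1 r2 c :: real and f g :: "real \<Rightarrow> real"
  assumes "r1 > 0" and "r2 > 0" and "r1\<^sup>2 + r2\<^sup>2 = 1" and "c > 0"
    and "(f = (\<lambda>x. cosh (r2 * sqrt c * x)) \<and> g = (\<lambda>y. r2 / r1 * sinh (r1 * sqrt c * y))) \<or>
         (f = (\<lambda>x. sinh (r2 * sqrt c * x)) \<and> g = (\<lambda>y. r2 / r1 * cosh (r1 * sqrt c * y))) \<or>
         (\<exists>a1 b1 \<epsilon>1 \<epsilon>2. a1 \<noteq> 0 \<and> b1 \<noteq> 0 \<and> \<epsilon>1\<^sup>2 = 1 \<and> \<epsilon>2\<^sup>2 = 1 \<and>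
            f = (\<lambda>x. a1 * exp (\<epsilon>1 * r2 * sqrt c * x)) \<and>
            g = (\<lambda>y. b1 * exp (\<epsilon>2 * r1 * sqrt c * y)))"
  shows "complete_surface (V_dom r1 r2 f g) (X_tilde r1 r2 c f g)"
  using assms(5) complete_cosh_sinh[OF assms(1-4)] complete_sinh_cosh[OF assms(1-4)]
    complete_exp_exp[OF assms(1-4)]
  by auto

end
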